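(* Assume that $\ell\in\mathbb{Z}_{>0}$, $a\in\mathbb{C}$ and $c\in\mathbb{C}\setminus\mathbb{Z}$. For any root $\lambda$ of $F(1-a,-\ell,2-c;x)$, which is a polynomial in the variable $x$ of degree at most $\ell$, we have $$F(a,1+\ell,c;\lambda)=-\frac{(1-c)\,q_0(\lambda)}{(1,\ell)\,(1-\lambda)^{\ell}},$$ $$F(c-a,\,c-1-\ell,\,c;\,\lambda)=-\frac{(1-c)}{(1,\ell)}(1-\lambda)^{a+1-c}q_0(\lambda),$$ where $q_0(x)$ is the polynomial in $x$ of degree at most $\ell-1$ given by $$q_0(x)=-\frac{(1,\ell)}{1-c}(1-x)^{c-a-1}F(c-a,\,c-1-\ell,\,c;\,x)+\frac{(2-c,\ell)}{1-c}F(a,1,c;x)\,F(1-a,-\ell,2-c;x).$$ For example, when $\ell=1$, we have $$F\left(a,2,c;\frac{c-2}{a-1}\right)=\frac{(a-1)(c-1)}{a+1-c},$$ $$F\left(c-a,\,c-2,\,c;\,\frac{c-2}{a-1}\right)=(c-1)\left(\frac{a+1-c}{a-1}\right)^{a+1-c}.$$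
   Context: For complex $\alpha$ and an integer $n\ge 0$, $(\alpha,n):=\Gamma(\alpha+n)/\Gamma(\alpha)$, i.e. $\alpha(\alpha+1)\cdots(\alpha+n-1)$. The hypergeometric series is $F(\alpha,\beta,\gamma;x):=\sum_{n=0}^{\infty}\frac{(\alpha,n)(\beta,n)}{(\gamma,n)(1,n)}x^n$. That $q_0(x)$ is a polynomial of degree at most $\ell-1$ is part of the assertion. *)

theory Defs
  imports "HOL-Complex_Analysis.Complex_Analysis"
begin

definition hyp_fps :: "complex \<Rightarrow> complex \<Rightarrow> complex \<Rightarrow> complex fps" where
  "hyp_fps a b c = fps_hypergeo [a, b] [c] 1"

(* (1,n) = n!, which fps_hypergeo supplies by itself. *)
lemma hyp_fps_nth:
  "fps_nth (hyp_fps a b c) n =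
     (pochhammer a n * pochhammer b n) / (pochhammer c n * pochhammer 1 n)"
  by (simp add: hyp_fps_def pochhammer_fact[symmetric] mult.commute)

definition hyp_cut :: "complex set" where
  "hyp_cut = complex_of_real ` {1..}"

(* The slit plane is star-shaped about 0, so such a function is unique on it if it exists. *)
definition hyp_cont :: "complex \<Rightarrow> complex \<Rightarrow> complex \<Rightarrow> complex \<Rightarrow> complex" where
  "hyp_cont a b c = (SOME f. f holomorphic_on (- hyp_cut) \<and>
      (\<forall>x\<in>ball 0 1. f x = eval_fps (hyp_fps a b c) x))"

(* The sum of the series wherever it converges, and the principal branch of its analytic
   continuation elsewhere.  On the cut the boundary value from the lower half-plane is taken:
   there 1 - x lies in the upper half-plane, so this is the side from which the principal power
   (1 - x) powr s is continuous (Arg = pi on the negative axis). *)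
definition hyp2F1 :: "complex \<Rightarrow> complex \<Rightarrow> complex \<Rightarrow> complex \<Rightarrow> complex" where
  "hyp2F1 a b c x =
     (if summable (\<lambda>n. fps_nth (hyp_fps a b c) n * x ^ n) then eval_fps (hyp_fps a b c) x
      else if x \<notin> hyp_cut then hyp_cont a b c x
      else Lim (at x within {z. Im z < 0}) (hyp_cont a b c))"

end

theory Submission
  imports Defs
begin

text \<open>
  The series \<open>F(a,1,c)\<close> satisfies a first-order inhomogeneous equation,
  \<open>x (1 - x) f' + (c - 1 - a x) f = c - 1\<close>, and the operator \<open>f \<mapsto> f + x f' / b\<close> raises the second
  parameter from \<open>b\<close> to \<open>b + 1\<close>.  Using the equation to eliminate derivatives after \<open>l\<close> such steps
  leaves a relation
  \<open>l! (1 - x)\<^sup>l F(a,1+l,c) = A\<^sub>l F(a,1,c) + B\<^sub>l\<close>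
  with polynomials \<open>A\<^sub>l\<close>, \<open>B\<^sub>l\<close>.  The recurrence for \<open>A\<^sub>l\<close> is that of \<open>(2-c,l) F(1-a,-l,2-c)\<close>
  (\<open>hyp_poly_Suc\<close>), and \<open>B\<^sub>l\<close> has degree at most \<open>l - 1\<close> (\<open>degree_rem_poly\<close>); see
  \<open>raise_param_closed_form\<close>.  Euler's transformation
  \<open>F(c-a, c-1-l, c) = (1 - x)\<^sup>a\<^sup>+\<^sup>1\<^sup>+\<^sup>l\<^sup>-\<^sup>c F(a,1+l,c)\<close> (\<open>euler_step_expansion\<close>) shows that
  \<open>q\<^sub>0 = - B\<^sub>l / (1 - c)\<close>.  At a root of \<open>F(1-a,-l,2-c)\<close> the term with \<open>F(a,1,c)\<close> drops out and both
  values are read off from \<open>B\<^sub>l\<close>.  For \<open>l = 1\<close>, \<open>B\<^sub>1 = c - 1\<close>.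

  The analytic part is that \<^const>\<open>hyp2F1\<close> is a sum, a continuation or a boundary value, depending
  on the point.  A continuation of \<open>F(a,1,c)\<close> is obtained as
  \<open>(1 - x)\<^sup>c\<^sup>-\<^sup>a\<^sup>-\<^sup>1 g\<close>, where \<open>g\<close> solves \<open>x g' + (c - 1) g = (c - 1) (1 - x)\<^sup>a\<^sup>-\<^sup>c\<close> on the slit plane
  (\<open>euler_ode_solution\<close>); the continuations of the other series are expressed by it.  The same
  equation shows that \<open>g\<close> has a limit from below at every point \<open>x > 1\<close> of the cut
  (\<open>euler_ode_limit_below_cut\<close>).  Finally, \<open>hyp2F1_eqI\<close> identifies all three kinds of values with
  limits of the continuation, so that the identities extend to every \<open>x \<noteq> 1\<close>.
\<close>

section \<open>Abel's limit theorem\<close>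

text \<open>Summation by parts: if \<open>r n\<close> is the tail of \<open>\<Sum>b\<close> from \<open>n\<close> on, then
  \<open>\<Sum>b\<^sub>n t\<^sup>n\<close> differs from \<open>\<Sum>b\<close> by \<open>(1 - t) \<Sum>r\<^sub>n\<^sub>+\<^sub>1 t\<^sup>n\<close>, and a null sequence has Abel mean zero.
  This is what identifies the sum of the series on the unit circle with the continuation.\<close>

lemma Abel_limit:
  fixes b :: "nat \<Rightarrow> complex"
  assumes "summable b"
  shows "((\<lambda>t. \<Sum>n. b n * of_real t ^ n) \<longlongrightarrow> suminf b) (at_left 1)"
proof -
  define r where "r n = suminf b - (\<Sum>k<n. b k)" for n
  have r0: "r \<longlonglongrightarrow> 0"
    unfolding r_def using tendsto_diff[OF tendsto_const summable_LIMSEQ[OF assms], of "suminf b"] by simp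
  have rSuc0: "(\<lambda>n. r (Suc n)) \<longlonglongrightarrow> 0"
    using r0 by (rule LIMSEQ_Suc)
  have b_eq: "b n = r n - r (Suc n)" for n by (simp add: r_def)
  obtain K where K: "\<And>n. norm (r n) \<le> K"
    using convergent_imp_Bseq[OF convergentI[OF r0]] by (auto simp: Bseq_def)
  have summ: "summable (\<lambda>n. norm (r (n + m)) * t ^ n)" if t: "0 < t" "t < 1" for m and t :: real
    by (rule summable_comparison_test'[of "\<lambda>n. K * t ^ n" 0])
       (use t K in \<open>auto intro!: summable_mult summable_geometric mult_right_mono\<close>)
  have summ_c: "summable (\<lambda>n. r (n + m) * of_real t ^ n)" if t: "0 < t" "t < 1" for m and t :: real
    by (rule summable_norm_cancel) (use summ[OF t] t in \<open>simp add: norm_mult norm_power\<close>)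
  have eq: "(\<Sum>n. b n * of_real t ^ n) = suminf b - (1 - of_real t) * (\<Sum>n. r (Suc n) * of_real t ^ n)"
    if t: "0 < t" "t < 1" for t :: real
  proof -
    have s0: "summable (\<lambda>n. r n * of_real t ^ n)" using summ_c[OF t, of 0] by simp
    have s1: "summable (\<lambda>n. r (Suc n) * of_real t ^ n)" using summ_c[OF t, of 1] by simp
    have "(\<Sum>n. b n * of_real t ^ n) = (\<Sum>n. r n * of_real t ^ n - r (Suc n) * of_real t ^ n)"
      by (simp add: b_eq left_diff_distrib)
    also have "\<dots> = (\<Sum>n. r n * of_real t ^ n) - (\<Sum>n. r (Suc n) * of_real t ^ n)"
      using suminf_diff[OF s0 s1] by simp
    also have "(\<Sum>n. r n * of_real t ^ n) = r 0 + (\<Sum>n. of_real t * (r (Suc n) * of_real t ^ n))"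
      using suminf_split_head[OF s0] by (simp add: mult_ac)
    also have "(\<Sum>n. of_real t * (r (Suc n) * of_real t ^ n)) = of_real t * (\<Sum>n. r (Suc n) * of_real t ^ n)"
      by (rule suminf_mult[OF s1])
    finally show ?thesis by (simp add: r_def algebra_simps)
  qed
  have "((\<lambda>t. (1 - of_real t) * (\<Sum>n. r (Suc n) * of_real t ^ n)) \<longlongrightarrow> 0) (at_left (1::real))"
  proof (rule tendstoI)
    fix e :: real assume e: "e > 0"
    obtain N where N: "\<And>n. n \<ge> N \<Longrightarrow> norm (r (Suc n)) < e / 2"
      using LIMSEQ_D[OF rSuc0, of "e / 2"] e by auto
    define M where "M = (\<Sum>n<N. norm (r (Suc n)))"
    have "((\<lambda>t. (1 - t) * M + e / 2) \<longlongrightarrow> (1 - 1) * M + e / 2) (at_left (1::real))"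
      by (intro tendsto_intros)
    then have "eventually (\<lambda>t. (1 - t) * M + e / 2 < e) (at_left (1::real))"
      by (rule order_tendstoD(2)) (use e in simp)
    moreover have "eventually (\<lambda>t. t \<in> {0<..<1}) (at_left (1::real))"
      by (rule eventually_at_left_real) simp
    ultimately show "eventually (\<lambda>t. dist ((1 - of_real t) * (\<Sum>n. r (Suc n) * of_real t ^ n)) 0 < e) (at_left (1::real))"
    proof eventually_elim
      case (elim t)
      then have t: "0 < t" "t < 1" by auto
      have s: "summable (\<lambda>n. norm (r (Suc n)) * t ^ n)" using summ[OF t, of 1] by simp
      have "norm (\<Sum>n. r (Suc n) * of_real t ^ n) \<le> (\<Sum>n. norm (r (Suc n)) * t ^ n)"
        using summable_norm[of "\<lambda>n. r (Suc n) * of_real t ^ n"] s t by (simp add: norm_mult norm_power)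
      also have "\<dots> = (\<Sum>n. norm (r (Suc (n + N))) * t ^ (n + N)) + (\<Sum>n<N. norm (r (Suc n)) * t ^ n)"
        using suminf_split_initial_segment[OF s, of N] by simp
      also have "(\<Sum>n<N. norm (r (Suc n)) * t ^ n) \<le> M"
        unfolding M_def by (intro sum_mono mult_left_le power_le_one) (use t in auto)
      also have "(\<Sum>n. norm (r (Suc (n + N))) * t ^ (n + N)) \<le> (\<Sum>n. e / 2 * t ^ n)"
      proof (rule suminf_le)
        show "norm (r (Suc (n + N))) * t ^ (n + N) \<le> e / 2 * t ^ n" for n
          by (intro mult_mono less_imp_le[OF N] power_decreasing) (use t e in auto)
        show "summable (\<lambda>n. norm (r (Suc (n + N))) * t ^ (n + N))"
          using summable_ignore_initial_segment[OF s, of N] by simp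
        show "summable (\<lambda>n. e / 2 * t ^ n)"
          using t by (intro summable_mult summable_geometric) auto
      qed
      also have "(\<Sum>n. e / 2 * t ^ n) = e / 2 * (1 / (1 - t))"
        using t suminf_mult[OF summable_geometric[of t], of "e / 2"] suminf_geometric[of t] by simp
      finally have "norm (\<Sum>n. r (Suc n) * of_real t ^ n) \<le> e / 2 * (1 / (1 - t)) + M" by simp
      then have "(1 - t) * norm (\<Sum>n. r (Suc n) * of_real t ^ n) \<le> (1 - t) * (e / 2 * (1 / (1 - t)) + M)"
        using t by (intro mult_left_mono) auto
      also have "\<dots> = (1 - t) * M + e / 2" using t by (simp add: field_simps)
      finally have "(1 - t) * norm (\<Sum>n. r (Suc n) * of_real t ^ n) < e" using elim by simp
      moreover have "norm (1 - complex_of_real t) = 1 - t"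
        using t by (metis abs_of_pos diff_gt_0_iff_gt norm_of_real of_real_1 of_real_diff)
      ultimately show ?case by (simp add: norm_mult)
    qed
  qed
  then have "((\<lambda>t. suminf b - (1 - of_real t) * (\<Sum>n. r (Suc n) * of_real t ^ n)) \<longlongrightarrow> suminf b - 0) (at_left (1::real))"
    by (intro tendsto_intros)
  then have "((\<lambda>t. \<Sum>n. b n * of_real t ^ n) \<longlongrightarrow> suminf b - 0) (at_left 1)"
  proof (rule Lim_transform_eventually)
    show "eventually (\<lambda>t. suminf b - (1 - of_real t) * (\<Sum>n. r (Suc n) * of_real t ^ n) = (\<Sum>n. b n * of_real t ^ n)) (at_left (1::real))"
      using eventually_at_left_real[of 0 "1::real", OF zero_less_one] by (rule eventually_mono) (auto simp: eq)
  qed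
  then show ?thesis by simp
qed

section \<open>The slit plane\<close>

lemma hyp_cut_iff: "x \<in> hyp_cut \<longleftrightarrow> Im x = 0 \<and> Re x \<ge> 1"
  unfolding hyp_cut_def by (auto simp: image_iff complex_eq_iff intro: bexI[of _ "Re x"])

lemma open_slit: "open (- hyp_cut)"
proof -
  have "hyp_cut = {x. Im x = 0} \<inter> {x. Re x \<ge> 1}" by (auto simp: hyp_cut_iff)
  also have "closed \<dots>"
    by (intro closed_Int closed_Collect_eq closed_Collect_le continuous_intros)
  finally show ?thesis by (simp add: open_closed)
qed

lemma scaled_in_slit:
  assumes "x \<in> - hyp_cut" "0 \<le> t" "t \<le> 1"
  shows "of_real t * x \<in> - hyp_cut"
proof -
  have "Re x \<ge> 1" if "t * Re x \<ge> 1"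
  proof (rule ccontr)
    assume "\<not> Re x \<ge> 1"
    then show False using that assms(2,3)
      by (smt (verit) mult_left_le_one_le mult_nonneg_nonpos)
  qed
  with assms show ?thesis by (auto simp: hyp_cut_iff)
qed

lemma zero_in_slit: "0 \<in> - hyp_cut"
  by (simp add: hyp_cut_iff)

lemma starlike_slit: "starlike (- hyp_cut)"
  unfolding starlike_def
proof (intro bexI[of _ 0] ballI subsetI)
  fix x y assume "x \<in> - hyp_cut" "y \<in> closed_segment 0 x"
  then show "y \<in> - hyp_cut"
    using scaled_in_slit by (auto simp: closed_segment_def scaleR_conv_of_real)
qed (rule zero_in_slit)

lemma connected_slit: "connected (- hyp_cut)"
  using starlike_slit starlike_imp_connected by blast

lemma ball_subset_slit: "ball 0 1 \<subseteq> - hyp_cut"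
proof
  fix x :: complex assume "x \<in> ball 0 1"
  then show "x \<in> - hyp_cut" using complex_Re_le_cmod[of x] by (auto simp: hyp_cut_iff)
qed

lemma one_minus_slit: "x \<in> - hyp_cut \<Longrightarrow> 1 - x \<notin> \<real>\<^sub>\<le>\<^sub>0"
  by (auto simp: hyp_cut_iff complex_nonpos_Reals_iff)

lemma slit_neq_1: "x \<in> - hyp_cut \<Longrightarrow> x \<noteq> 1"
  by (auto simp: hyp_cut_iff)

lemma eq_on_slit:
  assumes "f holomorphic_on - hyp_cut" "g holomorphic_on - hyp_cut"
    and "\<And>z. z \<in> ball 0 1 \<Longrightarrow> f z = g z" and "x \<in> - hyp_cut"
  shows "f x = g x"
  by (rule analytic_continuation_open[of "ball 0 1" "- hyp_cut" f g])
     (use assms open_slit connected_slit ball_subset_slit in auto)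

section \<open>The equation \<open>x g' + s g = h\<close> on star-shaped domains\<close>

text \<open>The solution is \<open>g x = \<integral>\<^sub>0\<^sup>1 t\<^sup>s\<^sup>-\<^sup>1 h(tx) dt\<close>: the integrand of \<open>x g' + s g\<close> is the
  \<open>t\<close>-derivative of \<open>t\<^sup>s h(tx)\<close>.  The bound on \<open>Re s\<close> makes the weight continuous at \<open>t = 0\<close>.\<close>

lemma euler_ode_solution_pos:
  assumes hol: "h holomorphic_on U" and U: "open U"
    and star: "\<And>x t. x \<in> U \<Longrightarrow> 0 \<le> t \<Longrightarrow> t \<le> 1 \<Longrightarrow> of_real t * x \<in> U"
    and s: "Re s > 1"
  shows "\<exists>g. g holomorphic_on U \<and> (\<forall>x\<in>U. x * deriv g x + s * g x = h x)"
proof -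
  define w where "w t = complex_of_real t powr (s - 1)" for t
  define g where "g x = integral {0..1} (\<lambda>t. w t * h (of_real t * x))" for x
  define g' where "g' x = integral {0..1} (\<lambda>t. w t * (of_real t * deriv h (of_real t * x)))" for x
  have hol': "deriv h holomorphic_on U" using hol U by (rule holomorphic_deriv)
  have contw: "continuous_on A w" if "A \<subseteq> {0..1}" for A
    unfolding w_def using that s by (intro continuous_intros) auto
  have dh: "(h has_field_derivative deriv h z) (at z)" if "z \<in> U" for z
    using hol U that by (rule holomorphic_derivI)
  have der: "(g has_field_derivative g' x) (at x)" if x: "x \<in> U" for x
  proof -
    obtain e where e: "e > 0" "ball x e \<subseteq> U" using U x openE by blast
    have inU: "of_real t * y \<in> U" if "y \<in> ball x e" "t \<in> {0..1}" for t y
      using star[of y t] that e by auto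
    have "((\<lambda>x. integral (cbox 0 1) (\<lambda>t. w t * h (of_real t * x))) has_field_derivative
            integral (cbox 0 1) (\<lambda>t. w t * (of_real t * deriv h (of_real t * x)))) (at x within ball x e)"
    proof (rule leibniz_rule_field_derivative)
      fix y t assume yt: "y \<in> ball x e" "t \<in> cbox 0 (1::real)"
      have "((\<lambda>y. h (of_real t * y)) has_field_derivative deriv h (of_real t * y) * (of_real t)) (at y within ball x e)"
        by (rule DERIV_chain2[OF dh]) (use inU yt in \<open>auto intro!: derivative_eq_intros\<close>)
      from DERIV_cmult[OF this, of "w t"]
      show "((\<lambda>y. w t * h (of_real t * y)) has_field_derivative
          w t * (of_real t * deriv h (of_real t * y))) (at y within ball x e)"
        by (simp add: mult_ac)
    next
      fix y assume y: "y \<in> ball x e"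
      show "(\<lambda>t. w t * h (of_real t * y)) integrable_on cbox 0 1"
        by (intro integrable_continuous continuous_intros contw
              continuous_on_compose2[OF holomorphic_on_imp_continuous_on[OF hol]])
           (use inU y in auto)
    next
      show "continuous_on (ball x e \<times> cbox 0 1) (\<lambda>(y, t). w t * (of_real t * deriv h (of_real t * y)))"
        unfolding split_beta
        by (intro continuous_intros continuous_on_compose2[OF contw[OF order_refl]]
              continuous_on_compose2[OF holomorphic_on_imp_continuous_on[OF hol']])
           (use inU in auto)
    qed (use e in auto)
    then show ?thesis
      using e by (simp add: g_def[abs_def] g'_def at_within_open[of x "ball x e"])
  qed
  have holg: "g holomorphic_on U"
    using der U by (auto simp: holomorphic_on_open)
  have "x * deriv g x + s * g x = h x" if x: "x \<in> U" for x
  proof -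
    have inU: "of_real t * x \<in> U" if "t \<in> {0..1}" for t
      using star[of x t] that x by auto
    define \<phi> where "\<phi> t = complex_of_real t powr s * h (of_real t * x)" for t
    have conth: "continuous_on {0..1} (\<lambda>t. h (of_real t * x))"
      by (intro continuous_intros continuous_on_compose2[OF holomorphic_on_imp_continuous_on[OF hol]])
         (use inU in auto)
    have conth': "continuous_on {0..1} (\<lambda>t. deriv h (of_real t * x))"
      by (intro continuous_intros continuous_on_compose2[OF holomorphic_on_imp_continuous_on[OF hol']])
         (use inU in auto)
    have wt: "complex_of_real t powr s = w t * of_real t" if "0 < t" for t
      using that powr_add[of "complex_of_real t" "s - 1" 1] by (simp add: w_def)
    have "((\<lambda>t. s * (w t * h (of_real t * x)) + x * (w t * (of_real t * deriv h (of_real t * x))))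
            has_integral (\<phi> 1 - \<phi> 0)) {0..1}"
    proof (rule fundamental_theorem_of_calculus_interior)
      show "continuous_on {0..1} \<phi>"
        unfolding \<phi>_def using s by (intro continuous_intros conth) auto
      fix t :: real assume t: "t \<in> {0<..<1}"
      have "((\<lambda>z. h (z * x)) has_field_derivative deriv h (of_real t * x) * x) (at (of_real t))"
        by (rule DERIV_chain2[OF dh]) (use inU t in \<open>auto intro!: derivative_eq_intros\<close>)
      moreover have "((\<lambda>z. z powr s) has_field_derivative s * complex_of_real t powr (s - 1)) (at (of_real t))"
        by (rule has_field_derivative_powr) (use t in auto)
      ultimately have "((\<lambda>z. z powr s * h (z * x)) has_field_derivative
              s * complex_of_real t powr (s - 1) * h (of_real t * x)
                + deriv h (of_real t * x) * x * complex_of_real t powr s) (at (of_real t))"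
        using DERIV_mult by blast
      also have "s * complex_of_real t powr (s - 1) * h (of_real t * x)
                + deriv h (of_real t * x) * x * complex_of_real t powr s
          = s * (w t * h (of_real t * x)) + x * (w t * (of_real t * deriv h (of_real t * x)))"
        using t by (simp add: wt) (simp add: w_def)
      finally show "(\<phi> has_vector_derivative
              s * (w t * h (of_real t * x)) + x * (w t * (of_real t * deriv h (of_real t * x)))) (at t)"
        unfolding \<phi>_def by (rule has_vector_derivative_real_field)
    qed auto
    moreover have "((\<lambda>t. s * (w t * h (of_real t * x)) + x * (w t * (of_real t * deriv h (of_real t * x))))
            has_integral (s * g x + x * g' x)) {0..1}"
      unfolding g_def g'_def
      by (intro has_integral_add has_integral_mult_right integrable_integral
            integrable_continuous_interval continuous_intros contw conth conth') auto
    ultimately have "\<phi> 1 - \<phi> 0 = s * g x + x * g' x"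
      by (rule has_integral_unique)
    moreover have "deriv g x = g' x" using der[OF x] by (rule DERIV_imp_deriv)
    ultimately show ?thesis by (simp add: \<phi>_def)
  qed
  with holg show ?thesis by blast
qed

text \<open>Splitting off the constant term, \<open>h = h 0 + x h\<^sub>1\<close> and \<open>g = h 0 / s + x g\<^sub>1\<close>, turns the equation
  into the same equation for \<open>g\<^sub>1\<close> with \<open>s + 1\<close> instead of \<open>s\<close>, so that finitely many steps
  reach the range in which the integral converges.\<close>

lemma euler_ode_solution:
  assumes hol: "h holomorphic_on U" and U: "open U"
    and star: "\<And>x t. x \<in> U \<Longrightarrow> 0 \<le> t \<Longrightarrow> t \<le> 1 \<Longrightarrow> of_real t * x \<in> U"
    and s: "\<And>n. s \<noteq> - of_nat n"
  shows "\<exists>g. g holomorphic_on U \<and> (\<forall>x\<in>U. x * deriv g x + s * g x = h x)"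
proof -
  obtain n where "Re s + real n > 1"
    using reals_Archimedean2[of "1 - Re s"] by (auto simp: algebra_simps)
  then show ?thesis using hol s
  proof (induction n arbitrary: s h)
    case 0
    then show ?case using euler_ode_solution_pos[OF _ U star, of h s] by auto
  next
    case (Suc n)
    define h1 where "h1 x = (if x = 0 then deriv h 0 else (h x - h 0) / (x - 0))" for x
    have h1: "h1 holomorphic_on U"
      unfolding h1_def by (rule pole_lemma_open[OF Suc.prems(2) U])
    have "s + 1 \<noteq> - of_nat n" for n
      using Suc.prems(3)[of "Suc n"] by (metis add_diff_cancel_right' diff_minus_eq_add minus_diff_eq
          of_nat_Suc add.commute uminus_add_conv_diff)
    then obtain g where g: "g holomorphic_on U" "\<And>x. x \<in> U \<Longrightarrow> x * deriv g x + (s + 1) * g x = h1 x"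
      using Suc.IH[of "s + 1" h1] h1 Suc.prems(1) by (auto simp: algebra_simps)
    have "x * deriv (\<lambda>x. h 0 / s + x * g x) x + s * (h 0 / s + x * g x) = h x" if x: "x \<in> U" for x
    proof -
      have "(g has_field_derivative deriv g x) (at x)"
        using g(1) U x by (rule holomorphic_derivI)
      then have "((\<lambda>x. h 0 / s + x * g x) has_field_derivative g x + x * deriv g x) (at x)"
        by (auto intro!: derivative_eq_intros)
      then have "deriv (\<lambda>x. h 0 / s + x * g x) x = g x + x * deriv g x"
        by (rule DERIV_imp_deriv)
      moreover have "s \<noteq> 0" using Suc.prems(3)[of 0] by simp
      ultimately have "x * deriv (\<lambda>x. h 0 / s + x * g x) x + s * (h 0 / s + x * g x)
          = h 0 + x * (x * deriv g x + (s + 1) * g x)"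
        by (simp add: algebra_simps)
      also have "\<dots> = h 0 + x * h1 x" using g(2)[OF x] by simp
      also have "\<dots> = h x" by (simp add: h1_def)
      finally show ?thesis .
    qed
    moreover have "(\<lambda>x. h 0 / s + x * g x) holomorphic_on U"
      using g(1) by (intro holomorphic_intros)
    ultimately show ?case by blast
  qed
qed

section \<open>Boundary values on the cut\<close>

text \<open>The set along which \<^const>\<open>hyp2F1\<close> takes its value at \<open>x\<close> as a limit of the continuation.  With
  it, points of the slit plane and points of the cut are treated alike: an identity between
  holomorphic functions on the slit plane passes to the limit at every \<open>x \<noteq> 1\<close>.\<close>

definition approach :: "complex \<Rightarrow> complex set" where
  "approach x = (if x \<in> hyp_cut then {z. Im z < 0} else - hyp_cut)"

lemma approach_subset: "approach x \<subseteq> - hyp_cut"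
  by (auto simp: approach_def hyp_cut_iff)

lemma approach_nontrivial: "at x within approach x \<noteq> bot"
proof (cases "x \<in> hyp_cut")
  case True
  have "x islimpt {z. Im z < 0}"
  proof (rule islimptI)
    fix T assume "x \<in> T" "open T"
    then obtain e where e: "e > 0" "ball x e \<subseteq> T" using openE by blast
    have "x - \<i> * of_real (e / 2) \<in> ball x e" using e by (simp add: dist_norm norm_mult)
    from e(2) this have "x - \<i> * of_real (e / 2) \<in> T" by (rule subsetD)
    then show "\<exists>y\<in>{z. Im z < 0}. y \<in> T \<and> y \<noteq> x"
      using e(1) True by (intro bexI[of _ "x - \<i> * of_real (e / 2)"]) (simp_all add: hyp_cut_iff)
  qed
  moreover have "approach x = {z. Im z < 0}" using True by (simp add: approach_def)
  ultimately show ?thesis by (simp add: trivial_limit_within)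
next
  case False
  then have "at x within approach x = at x"
    using open_slit at_within_open[of x "- hyp_cut"] by (simp add: approach_def)
  then show ?thesis by simp
qed

text \<open>The right-hand side is holomorphic on the whole half-plane \<open>Re z > 1\<close>: it continues the
  principal power across the cut from below.\<close>

lemma one_minus_powr_below_cut:
  assumes "Re z > 1" "Im z \<le> 0"
  shows "(1 - z) powr s = exp (s * (Ln (z - 1) + \<i> * pi))"
proof -
  have z: "z \<noteq> 1" using assms by auto
  have "Ln (- (z - 1)) = Ln (z - 1) + \<i> * pi"
    using assms z Ln_minus[of "z - 1"] by simp
  then show ?thesis using z by (simp add: powr_def)
qed

lemma below_cut_eventually:
  assumes "Re x > 1"
  shows "eventually (\<lambda>z. Re z > 1 \<and> Im z < 0) (at x within {z. Im z < 0})"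
proof -
  have "open {z. Re z > 1}" by (rule open_halfspace_Re_gt)
  then show ?thesis
    unfolding eventually_at_topological using assms by (intro exI[of _ "{z. Re z > 1}"]) auto
qed

lemma one_minus_powr_tendsto:
  assumes "x \<noteq> 1"
  shows "((\<lambda>z. (1 - z) powr s) \<longlongrightarrow> (1 - x) powr s) (at x within approach x)"
proof (cases "x \<in> hyp_cut")
  case True
  with assms have x: "Re x > 1" "Im x = 0" by (auto simp: hyp_cut_iff complex_eq_iff)
  have "((\<lambda>z. exp (s * (Ln (z - 1) + \<i> * pi))) \<longlongrightarrow> exp (s * (Ln (x - 1) + \<i> * pi))) (at x within {z. Im z < 0})"
    by (intro tendsto_intros) (use x in \<open>auto simp: complex_nonpos_Reals_iff\<close>)
  then have "((\<lambda>z. (1 - z) powr s) \<longlongrightarrow> exp (s * (Ln (x - 1) + \<i> * pi))) (at x within {z. Im z < 0})"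
    by (rule Lim_transform_eventually[OF _ eventually_mono[OF below_cut_eventually[OF x(1)]]])
       (simp add: one_minus_powr_below_cut)
  then show ?thesis using True x by (simp add: approach_def one_minus_powr_below_cut)
next
  case False
  then show ?thesis
    using one_minus_slit[of x] by (intro tendsto_intros) auto
qed

lemma holomorphic_tendsto_approach:
  assumes "f holomorphic_on - hyp_cut" "x \<notin> hyp_cut"
  shows "(f \<longlongrightarrow> f x) (at x within approach x)"
  using holomorphic_on_imp_continuous_on[OF assms(1)] assms(2)
  by (simp add: approach_def continuous_on_def)

lemma eventually_approach_slit: "eventually (\<lambda>z. z \<in> - hyp_cut) (at x within approach x)"
  using approach_subset[of x] by (auto simp: eventually_at_topological)

text \<open>Multiplied by \<open>z\<^sup>s\<close>, a solution has the derivative \<open>k z\<^sup>s\<^sup>-\<^sup>1 (1 - z)\<^sup>u\<close> below the cut.  That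
  derivative continues to the convex half-plane \<open>Re z > 1\<close> and has a primitive there, which differs
  from \<open>z\<^sup>s g\<close> by a constant below the cut and is continuous on the cut.\<close>

lemma euler_ode_limit_below_cut:
  assumes hol: "g holomorphic_on - hyp_cut"
    and ode: "\<And>z. z \<in> - hyp_cut \<Longrightarrow> z * deriv g z + s * g z = k * (1 - z) powr u"
    and x: "x \<in> hyp_cut" "x \<noteq> 1"
  shows "\<exists>L. (g \<longlongrightarrow> L) (at x within approach x)"
proof -
  have x: "Re x > 1" "Im x = 0" using x by (auto simp: hyp_cut_iff complex_eq_iff)
  define H where "H = {z. Re z > 1}"
  define q where "q z = z powr (s - 1) * (k * exp (u * (Ln (z - 1) + \<i> * pi)))" for z
  have "q holomorphic_on H"
    unfolding q_def H_def by (intro holomorphic_intros) (auto simp: complex_nonpos_Reals_iff)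
  then obtain Q where Q: "\<And>z. z \<in> H \<Longrightarrow> (Q has_field_derivative q z) (at z within H)"
    using holomorphic_convex_primitive'[of H q] by (auto simp: H_def convex_halfspace_Re_gt open_halfspace_Re_gt)
  have openH: "open H" by (simp add: H_def open_halfspace_Re_gt)
  have dQ: "(Q has_field_derivative q z) (at z)" if "z \<in> H" for z
    using Q[OF that] at_within_open[OF that openH] by simp
  define D where "D = H \<inter> {z. Im z < 0}"
  have "\<exists>C. \<forall>z\<in>D. z powr s * g z - Q z = C"
  proof (rule has_field_derivative_zero_constant)
    show "convex D" by (simp add: D_def H_def convex_Int convex_halfspace_Re_gt convex_halfspace_Im_lt)
    fix z assume "z \<in> D"
    then have z: "Re z > 1" "Im z < 0" "z \<in> H" "z \<in> - hyp_cut" "z \<noteq> 0" "z \<notin> \<real>\<^sub>\<le>\<^sub>0"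
      by (auto simp: D_def H_def hyp_cut_iff complex_nonpos_Reals_iff)
    have dg: "(g has_field_derivative deriv g z) (at z)"
      using hol open_slit z(4) by (rule holomorphic_derivI)
    have "z powr s = z powr (s - 1) * z"
      using powr_add[of z "s - 1" 1] z(5) by simp
    then have "s * z powr (s - 1) * g z + z powr s * deriv g z - q z
        = z powr (s - 1) * (z * deriv g z + s * g z - k * (1 - z) powr u)"
      using z by (simp add: q_def one_minus_powr_below_cut algebra_simps)
    then have "s * z powr (s - 1) * g z + z powr s * deriv g z - q z = 0"
      using ode[OF z(4)] by simp
    moreover have "((\<lambda>z. z powr s * g z - Q z) has_field_derivative
        s * z powr (s - 1) * g z + z powr s * deriv g z - q z) (at z)"
      using DERIV_diff[OF DERIV_mult[OF has_field_derivative_powr[OF z(6), of s] dg] dQ[OF z(3)]]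
      by (simp add: mult_ac)
    ultimately show "((\<lambda>z. z powr s * g z - Q z) has_field_derivative 0) (at z within D)"
      by (simp add: has_field_derivative_at_within)
  qed
  then obtain C where C: "\<And>z. z \<in> D \<Longrightarrow> z powr s * g z - Q z = C" by blast
  have "isCont Q x" using dQ[of x] x by (auto simp: H_def intro: DERIV_isCont)
  then have "((\<lambda>z. (Q z + C) / z powr s) \<longlongrightarrow> (Q x + C) / x powr s) (at x within {z. Im z < 0})"
    using x by (intro tendsto_intros isCont_tendsto_compose[of x Q])
      (auto simp: complex_nonpos_Reals_iff powr_def)
  moreover have "eventually (\<lambda>z. (Q z + C) / z powr s = g z) (at x within {z. Im z < 0})"
    using below_cut_eventually[OF x(1)]
  proof eventually_elim
    case (elim z)
    then have "z \<in> D" "z \<noteq> 0" by (auto simp: D_def H_def)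
    with C[of z] have "Q z + C = z powr s * g z" "z powr s \<noteq> 0" by (auto simp: powr_def)
    then show ?case by simp
  qed
  ultimately have "(g \<longlongrightarrow> (Q x + C) / x powr s) (at x within {z. Im z < 0})"
    by (rule Lim_transform_eventually)
  then show ?thesis using assms(3) by (auto simp: approach_def)
qed

section \<open>Values of the hypergeometric function from a continuation\<close>

lemma nonint_add_nat:
  assumes "(c :: complex) \<notin> \<int>" shows "c + of_nat n \<noteq> 0" "c - of_nat n \<noteq> 0"
  using assms by (metis Ints_minus Ints_of_nat eq_neg_iff_add_eq_0, metis Ints_of_nat eq_iff_diff_eq_0)

lemma hyp_fps_eventually_0:
  assumes "a = - of_nat m \<or> b = - of_nat m" "n > m"
  shows "fps_nth (hyp_fps a b c) n = 0"
  using assms by (auto simp: hyp_fps_nth pochhammer_of_nat_eq_0_lemma)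

lemma hyp_fps_Suc:
  assumes "c \<notin> \<int>"
  shows "fps_nth (hyp_fps a b c) (Suc n) * ((c + of_nat n) * of_nat (Suc n))
           = fps_nth (hyp_fps a b c) n * ((a + of_nat n) * (b + of_nat n))"
proof -
  have c: "c + of_nat k \<noteq> 0" for k
    using nonint_add_nat(1)[OF assms] .
  then have "pochhammer c k \<noteq> 0" for k
    by (metis add.commute eq_neg_iff_add_eq_0 pochhammer_eq_0_iff)
  moreover have "(pochhammer 1 k :: complex) \<noteq> 0" for k
    by (simp add: pochhammer_fact[symmetric])
  moreover have "(1 :: complex) + of_nat n \<noteq> 0"
    by (metis of_nat_Suc of_nat_neq_0)
  ultimately show ?thesis
    using c[of n] by (simp add: hyp_fps_nth pochhammer_rec' divide_simps)
qed

lemma shifted_ratio_tendsto_1: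
  fixes p q :: complex
  assumes "\<And>n. q + of_nat n \<noteq> 0"
  shows "(\<lambda>n. (p + of_nat n) / (q + of_nat n)) \<longlonglongrightarrow> 1"
proof -
  have "filterlim (\<lambda>n. q + of_nat n) at_infinity sequentially"
    by (intro tendsto_add_filterlim_at_infinity[OF tendsto_const] tendsto_of_nat)
  then have "(\<lambda>n. 1 + (p - q) / (q + of_nat n)) \<longlonglongrightarrow> 1 + 0"
    by (intro tendsto_intros tendsto_divide_0[OF tendsto_const])
  moreover have "1 + (p - q) / (q + of_nat n) = (p + of_nat n) / (q + of_nat n)" for n
    using assms[of n] by (simp add: field_simps)
  ultimately show ?thesis by simp
qed

text \<open>The quotient of consecutive coefficients tends to 1, so the radius of convergence is 1 unless
  the series terminates.\<close>

lemma hyp_fps_not_summable: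
  assumes c: "c \<notin> \<int>"
    and a: "\<And>n. a \<noteq> - of_nat n" and b: "\<And>n. b \<noteq> - of_nat n" and x: "norm x > 1"
  shows "\<not> summable (\<lambda>n. fps_nth (hyp_fps a b c) n * x ^ n)"
proof -
  let ?F = "fps_nth (hyp_fps a b c)"
  have a': "a + of_nat n \<noteq> 0" and b': "b + of_nat n \<noteq> 0" for n
    using a[of n] b[of n] by (auto simp: add_eq_0_iff2)
  have c': "c + of_nat n \<noteq> 0" for n
    using nonint_add_nat(1)[OF c] .
  have nz: "?F n \<noteq> 0" for n
  proof (induction n)
    case 0
    then show ?case by (simp add: hyp_fps_nth)
  next
    case (Suc n)
    then show ?case using hyp_fps_Suc[OF c, of a b n] a'[of n] b'[of n] by auto
  qed
  have "(\<lambda>n. norm (((c + of_nat n) / (a + of_nat n)) * ((1 + of_nat n) / (b + of_nat n)))) \<longlonglongrightarrow> norm (1 * 1 :: complex)"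
    by (intro tendsto_intros shifted_ratio_tendsto_1 a' b')
  moreover have "norm (((c + of_nat n) / (a + of_nat n)) * ((1 + of_nat n) / (b + of_nat n))) = norm (?F n) / norm (?F (Suc n))" for n
  proof -
    have "?F n / ?F (Suc n) = ((c + of_nat n) / (a + of_nat n)) * ((1 + of_nat n) / (b + of_nat n))"
      using hyp_fps_Suc[OF c, of a b n] nz[of "Suc n"] a'[of n] b'[of n]
      by (simp add: frac_eq_eq mult_ac)
    then show ?thesis by (simp only: norm_divide[symmetric])
  qed
  ultimately have "conv_radius ?F = 1"
    by (intro conv_radius_ratio_limit_nonzero[of _ 1]) (auto simp: one_ereal_def)
  then show ?thesis using x by (intro not_summable_outside_conv_radius) (simp add: one_ereal_def)
qed

text \<open>The link between the case distinction in \<^const>\<open>hyp2F1\<close> and a concrete continuation \<open>f\<close>.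
  If the series diverges at \<open>x\<close>, uniqueness of the continuation suffices.  If it converges and
  \<open>norm x \<le> 1\<close>, then \<open>x\<close> is off the cut and Abel's theorem on the radius through \<open>x\<close> applies.  If it
  converges and \<open>norm x > 1\<close>, it is a polynomial, which agrees with \<open>f\<close> on the slit plane.\<close>

lemma hyp2F1_eqI:
  assumes c: "c \<notin> \<int>" and hol: "f holomorphic_on - hyp_cut"
    and exp: "f has_fps_expansion hyp_fps a b c" and x: "x \<noteq> 1"
    and lim: "(f \<longlongrightarrow> L) (at x within approach x)"
  shows "hyp2F1 a b c x = L"
proof -
  let ?F = "hyp_fps a b c"
  have on_ball: "f z = eval_fps ?F z" if "z \<in> ball 0 1" for z
    using has_fps_expansion_imp_eval_fps_eq[OF exp, of z 1] that
      holomorphic_on_subset[OF hol ball_subset_slit] by simp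
  have L: "L = f x" if "x \<notin> hyp_cut"
    using tendsto_unique[OF approach_nontrivial lim holomorphic_tendsto_approach[OF hol that]] .
  show ?thesis
  proof (cases "summable (\<lambda>n. fps_nth ?F n * x ^ n)")
    case False
    have "hyp_cont a b c holomorphic_on - hyp_cut \<and> (\<forall>z\<in>ball 0 1. hyp_cont a b c z = eval_fps ?F z)"
      unfolding hyp_cont_def by (rule someI[of _ f]) (use hol on_ball in blast)
    then have cont: "hyp_cont a b c z = f z" if "z \<in> - hyp_cut" for z
      using eq_on_slit[OF _ hol _ that] on_ball by simp
    show ?thesis
    proof (cases "x \<in> hyp_cut")
      case False
      with \<open>\<not> summable _\<close> show ?thesis by (simp add: hyp2F1_def cont L)
    next
      case True
      have "(hyp_cont a b c \<longlongrightarrow> L) (at x within approach x)"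
        by (rule Lim_transform_eventually[OF lim eventually_mono[OF eventually_approach_slit]])
           (simp add: cont)
      then have "Lim (at x within {z. Im z < 0}) (hyp_cont a b c) = L"
        using approach_nontrivial[of x] True by (intro tendsto_Lim) (auto simp: approach_def)
      with True False show ?thesis by (simp add: hyp2F1_def)
    qed
  next
    case True
    then have val: "hyp2F1 a b c x = eval_fps ?F x" by (simp add: hyp2F1_def)
    show ?thesis
    proof (cases "norm x \<le> 1")
      case norm: True
      then have nc: "x \<notin> hyp_cut"
        using x complex_Re_le_cmod[of x] by (auto simp: hyp_cut_iff complex_eq_iff)
      have "((\<lambda>t. f (of_real t * x)) \<longlongrightarrow> f (of_real 1 * x)) (at_left (1::real))"
      proof (rule isCont_tendsto_compose[of _ f])
        have "f field_differentiable at x"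
          using holomorphic_on_imp_differentiable_at[OF hol open_slit] nc by simp
        then show "isCont f (of_real 1 * x)"
          by (simp add: field_differentiable_imp_continuous_at)
        show "((\<lambda>t. of_real t * x) \<longlongrightarrow> of_real 1 * x) (at_left (1::real))"
          by (intro tendsto_intros)
      qed
      moreover have "((\<lambda>t. f (of_real t * x)) \<longlongrightarrow> eval_fps ?F x) (at_left (1::real))"
      proof (rule Lim_transform_eventually)
        show "((\<lambda>t. \<Sum>n. (fps_nth ?F n * x ^ n) * of_real t ^ n) \<longlongrightarrow> eval_fps ?F x) (at_left (1::real))"
          unfolding eval_fps_def by (rule Abel_limit[OF True])
        show "eventually (\<lambda>t. (\<Sum>n. (fps_nth ?F n * x ^ n) * of_real t ^ n) = f (of_real t * x)) (at_left (1::real))"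
          using eventually_at_left_real[of 0 "1::real", OF zero_less_one]
        proof eventually_elim
          case (elim t)
          have "norm (of_real t * x) \<le> t"
            using elim norm by (simp add: norm_mult mult_left_le)
          then have "norm (of_real t * x) < 1" using elim by simp
          then show ?case
            by (simp add: on_ball eval_fps_def power_mult_distrib mult_ac)
        qed
      qed
      ultimately have "eval_fps ?F x = f x"
        using tendsto_unique[OF trivial_limit_at_left_real] by fastforce
      with val L[OF nc] show ?thesis by simp
    next
      case False
      with True hyp_fps_not_summable[OF c] obtain m where m: "a = - of_nat m \<or> b = - of_nat m"
        by (meson not_le)
      have ev: "eval_fps ?F z = (\<Sum>n\<le>m. fps_nth ?F n * z ^ n)" for z
        unfolding eval_fps_def
        by (rule suminf_finite) (use hyp_fps_eventually_0[OF m] in auto)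
      have hol': "eval_fps ?F holomorphic_on A" for A
        unfolding ev by (intro holomorphic_intros)
      have eq: "f z = eval_fps ?F z" if "z \<in> - hyp_cut" for z
        using eq_on_slit[OF hol hol' on_ball that] .
      have "isCont (eval_fps ?F) x"
        using hol'[of UNIV] by (auto dest!: holomorphic_on_imp_continuous_on simp: continuous_on_eq_continuous_at)
      then have "(eval_fps ?F \<longlongrightarrow> eval_fps ?F x) (at x within approach x)"
        by (simp add: continuous_at_imp_continuous_at_within flip: continuous_within)
      then have "(f \<longlongrightarrow> eval_fps ?F x) (at x within approach x)"
        by (rule Lim_transform_eventually[OF _ eventually_mono[OF eventually_approach_slit]])
           (simp add: eq)
      with lim val show ?thesis using tendsto_unique[OF approach_nontrivial] by blast
    qed
  qed
qed

section \<open>Continuation of the hypergeometric series\<close>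

lemma theta_has_fps_expansion:
  assumes "f has_fps_expansion (F :: complex fps)"
  shows "(\<lambda>z. z * deriv f z) has_fps_expansion Abs_fps (\<lambda>n. of_nat n * fps_nth F n)"
proof -
  have "(\<lambda>z. z * deriv f z) has_fps_expansion fps_X * fps_deriv F"
    using assms by (intro fps_expansion_intros)
  also have "fps_X * fps_deriv F = Abs_fps (\<lambda>n. of_nat n * fps_nth F n)"
    by (rule fps_ext) (simp add: fps_X_mult_nth)
  finally show ?thesis .
qed

lemma fps_eq_on_slit:
  assumes "f has_fps_expansion F" "g has_fps_expansion G" "\<And>z. z \<in> - hyp_cut \<Longrightarrow> f z = g z"
  shows "(F :: complex fps) = G"
proof -
  have "eventually (\<lambda>z. f z = g z) (nhds 0)"
    using eventually_nhds_in_open[OF open_slit zero_in_slit] by eventually_elim (rule assms(3))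
  then have "f has_fps_expansion G"
    using assms(2) by (simp add: has_fps_expansion_cong)
  with assms(1) show ?thesis by (rule fps_expansion_unique_complex)
qed

lemma one_minus_powr_has_fps_expansion:
  "(\<lambda>z::complex. (1 - z) powr s) has_fps_expansion Abs_fps (\<lambda>n. pochhammer (- s) n / fact n)"
proof -
  have "((\<lambda>z::complex. (1 + z) powr s) \<circ> (\<lambda>z. - z)) has_fps_expansion (fps_binomial s oo - fps_X)"
    by (intro has_fps_expansion_compose has_fps_expansion_binomial_complex fps_expansion_intros) simp
  also have "fps_binomial s oo - fps_X = Abs_fps (\<lambda>n. pochhammer (- s) n / fact n)"
    by (rule fps_ext) (simp add: fps_compose_uminus' gbinomial_pochhammer flip: power_mult_distrib)
  finally show ?thesis by (simp add: o_def)
qed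

lemma one_minus_powr_deriv:
  assumes "z \<in> - hyp_cut"
  shows "((\<lambda>z. (1 - z) powr s) has_field_derivative - (s * (1 - z) powr s / (1 - z))) (at z)"
proof -
  have "((\<lambda>z. (1 - z) powr s) has_field_derivative s * (1 - z) powr (s - 1) * (- 1)) (at z)"
    by (rule DERIV_chain2[where f = "\<lambda>z. z powr s" and g = "\<lambda>z. 1 - z"])
       (auto intro!: derivative_eq_intros has_field_derivative_powr one_minus_slit assms)
  then show ?thesis using slit_neq_1[OF assms] by (simp add: powr_diff)
qed

lemma one_minus_powr_holomorphic: "(\<lambda>z. (1 - z) powr s) holomorphic_on - hyp_cut"
  using one_minus_powr_deriv open_slit by (auto simp: holomorphic_on_open)

lemma pochhammer_shift:
  "pochhammer b n * (b + of_nat n) = b * pochhammer (b + 1) n" for b :: complex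
  by (metis pochhammer_rec pochhammer_rec' mult.commute)

lemma hyp_fps_raise:
  assumes "b \<noteq> 0"
  shows "fps_nth (hyp_fps a (b + 1) c) n = fps_nth (hyp_fps a b c) n * (b + of_nat n) / b"
proof -
  have "pochhammer (b + 1) n = pochhammer b n * (b + of_nat n) / b"
    using pochhammer_shift[of b n] assms by (simp add: field_simps)
  then show ?thesis by (simp add: hyp_fps_nth mult_ac)
qed

text \<open>Since \<open>(c - 1, n) / (c, n) = (c - 1) / (c - 1 + n)\<close>, the series \<open>F(c-a, c-1, c)\<close> arises from the
  binomial series of \<open>(1 - x)\<^sup>a\<^sup>-\<^sup>c\<close> by dividing the coefficients by \<open>(c - 1 + n) / (c - 1)\<close>, that
  is, by solving the equation of the section on star-shaped domains with \<open>s = c - 1\<close>.\<close>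

lemma continuation_base:
  assumes c: "c \<notin> \<int>"
  shows "\<exists>g. g holomorphic_on - hyp_cut \<and>
    (\<forall>z\<in>- hyp_cut. z * deriv g z + (c - 1) * g z = (c - 1) * (1 - z) powr (a - c)) \<and>
    g has_fps_expansion hyp_fps (c - a) (c - 1) c"
proof -
  have "c - 1 \<noteq> - of_nat n" for n
  proof
    assume "c - 1 = - of_nat n"
    then have "c = of_int (1 - int n)" by (simp add: algebra_simps)
    with c show False by (metis Ints_of_int)
  qed
  then obtain g where hol: "g holomorphic_on - hyp_cut"
    and ode: "\<And>z. z \<in> - hyp_cut \<Longrightarrow> z * deriv g z + (c - 1) * g z = (c - 1) * (1 - z) powr (a - c)"
    using euler_ode_solution[of "\<lambda>z. (c - 1) * (1 - z) powr (a - c)" "- hyp_cut" "c - 1"]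
      holomorphic_on_mult[OF holomorphic_on_const one_minus_powr_holomorphic] open_slit scaled_in_slit
    by blast
  define G where "G = fps_expansion g 0"
  have G: "g has_fps_expansion G"
    unfolding G_def by (rule has_fps_expansion_fps_expansion[OF open_slit zero_in_slit hol])
  have "Abs_fps (\<lambda>n. of_nat n * fps_nth G n) + fps_const (c - 1) * G
      = fps_const (c - 1) * Abs_fps (\<lambda>n. pochhammer (- (a - c)) n / fact n)"
    using fps_eq_on_slit[OF has_fps_expansion_add[OF theta_has_fps_expansion[OF G]
            has_fps_expansion_mult[OF has_fps_expansion_const G]]
          has_fps_expansion_mult[OF has_fps_expansion_const one_minus_powr_has_fps_expansion] ode] .
  then have "fps_nth (Abs_fps (\<lambda>n. of_nat n * fps_nth G n) + fps_const (c - 1) * G) n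
      = fps_nth (fps_const (c - 1) * Abs_fps (\<lambda>n. pochhammer (- (a - c)) n / fact n)) n" for n
    by (rule arg_cong)
  then have rec: "(c - 1 + of_nat n) * fps_nth G n = (c - 1) * (pochhammer (c - a) n / fact n)" for n
    by (simp add: algebra_simps)
  have "G = hyp_fps (c - a) (c - 1) c"
  proof (rule fps_ext)
    fix n
    have nz: "c - 1 + of_nat n \<noteq> 0"
      using \<open>c - 1 \<noteq> - of_nat n\<close> by (simp add: eq_neg_iff_add_eq_0)
    have "pochhammer c n \<noteq> 0"
      using nonint_add_nat[OF c] by (metis add.commute eq_neg_iff_add_eq_0 pochhammer_eq_0_iff)
    moreover have "pochhammer (c - 1) n * (c - 1 + of_nat n) = (c - 1) * pochhammer c n"
      using pochhammer_shift[of "c - 1" n] by simp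
    ultimately have "(c - 1) / (c - 1 + of_nat n) = pochhammer (c - 1) n / pochhammer c n"
      using nz by (simp add: frac_eq_eq mult.commute)
    moreover have "fps_nth G n = (c - 1 + of_nat n) * fps_nth G n / (c - 1 + of_nat n)"
      using nz by simp
    then have "fps_nth G n = (c - 1) / (c - 1 + of_nat n) * (pochhammer (c - a) n / fact n)"
      unfolding rec by simp
    ultimately show "fps_nth G n = fps_nth (hyp_fps (c - a) (c - 1) c) n"
      by (simp add: hyp_fps_nth pochhammer_fact[symmetric] mult_ac)
  qed
  with hol ode G show ?thesis by blast
qed

text \<open>Because \<open>(1, n) / n! = 1\<close>, the coefficients of \<open>F(a,1,c)\<close> obey a first-order recurrence whose
  multipliers \<open>c + n\<close> never vanish; the differential equation expresses this recurrence.\<close>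

lemma first_order_ode_expansion:
  assumes c: "c \<notin> \<int>" and F: "f has_fps_expansion F"
    and ode: "\<And>z. z \<in> - hyp_cut \<Longrightarrow> (1 - z) * (z * deriv f z) + (c - 1 - a * z) * f z = c - 1"
  shows "F = hyp_fps a 1 c"
proof -
  define T where "T = Abs_fps (\<lambda>n. of_nat n * fps_nth F n)"
  have T: "(\<lambda>z. z * deriv f z) has_fps_expansion T"
    unfolding T_def using F by (rule theta_has_fps_expansion)
  have "(\<lambda>z. (1 - z) * (z * deriv f z) + (c - 1 - a * z) * f z) has_fps_expansion
      (1 - fps_X) * T + (fps_const (c - 1) - fps_const a * fps_X) * F"
    by (intro has_fps_expansion_add has_fps_expansion_mult has_fps_expansion_diff
          has_fps_expansion_1 has_fps_expansion_const has_fps_expansion_fps_X F T)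
  from fps_eq_on_slit[OF this has_fps_expansion_const ode]
  have "(1 - fps_X) * T + (fps_const (c - 1) - fps_const a * fps_X) * F = fps_const (c - 1)" .
  then have "T - fps_X * T + fps_const (c - 1) * F - fps_const a * (fps_X * F) = fps_const (c - 1)"
    by (simp add: algebra_simps)
  then have nth: "fps_nth (T - fps_X * T + fps_const (c - 1) * F - fps_const a * (fps_X * F)) n
      = fps_nth (fps_const (c - 1)) n" for n
    by (rule arg_cong)
  show ?thesis
  proof (rule fps_ext)
    fix n
    show "fps_nth F n = fps_nth (hyp_fps a 1 c) n"
    proof (induction n)
      case 0
      have "c - 1 \<noteq> 0" using nonint_add_nat(2)[OF c, of 1] by simp
      with nth[of 0] show ?case by (simp add: T_def hyp_fps_nth)
    next
      case (Suc n)
      have "(c + of_nat n) * fps_nth F (Suc n) = (a + of_nat n) * fps_nth F n"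
        using nth[of "Suc n"] by (simp add: T_def) (simp add: algebra_simps)
      moreover have "(c + of_nat n) * fps_nth (hyp_fps a 1 c) (Suc n) * of_nat (Suc n)
          = (a + of_nat n) * fps_nth (hyp_fps a 1 c) n * of_nat (Suc n)"
        using hyp_fps_Suc[OF c, of a 1 n] by (simp add: mult_ac)
      then have "(c + of_nat n) * fps_nth (hyp_fps a 1 c) (Suc n) = (a + of_nat n) * fps_nth (hyp_fps a 1 c) n"
        using of_nat_neq_0 mult_right_cancel by blast
      ultimately show ?case
        using Suc nonint_add_nat(1)[OF c, of n] by (metis mult_left_cancel)
    qed
  qed
qed

text \<open>The induction step for Euler's transformation
  \<open>F(c-a, c-b, c; x) = (1 - x)\<^sup>a\<^sup>+\<^sup>b\<^sup>-\<^sup>c F(a, b, c; x)\<close>.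
  The operator \<open>f \<mapsto> f + x f' / b\<close> raises \<open>b\<close> by 1 in \<open>F(a,b,c)\<close>.  Conjugated with the power of
  \<open>1 - x\<close>, it becomes a first-order operator on \<open>F(c-a, c-b, c)\<close>, and comparing coefficients shows that
  this operator lowers \<open>c - b\<close> by 1.\<close>

lemma euler_step_expansion:
  assumes c: "c \<notin> \<int>" and b: "b \<noteq> 0" "\<And>n. c - b + of_nat n \<noteq> 0"
    and hol: "f holomorphic_on - hyp_cut"
    and H: "(\<lambda>z. (1 - z) powr (a + b - c) * f z) has_fps_expansion hyp_fps (c - a) (c - b) c"
  shows "(\<lambda>z. (1 - z) powr (a + (b + 1) - c) * (f z + z * deriv f z / b))
           has_fps_expansion hyp_fps (c - a) (c - (b + 1)) c"
proof -
  define s where "s = a + b - c"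
  define h where "h z = (1 - z) powr s * f z" for z
  define H where "H = hyp_fps (c - a) (c - b) c"
  define T where "T = Abs_fps (\<lambda>n. of_nat n * fps_nth H n)"
  define f' where "f' z = (1 - z) powr (a + (b + 1) - c) * (f z + z * deriv f z / b)" for z
  have hH: "h has_fps_expansion H"
    using assms(5) by (simp add: h_def[abs_def] H_def s_def)
  then have hT: "(\<lambda>z. z * deriv h z) has_fps_expansion T"
    unfolding T_def by (rule theta_has_fps_expansion)
  \<comment> \<open>the conjugated operator applied to \<open>h\<close>, as a power series\<close>
  define R where "R = fps_const (1 / b) * ((1 - fps_X) * (fps_const b * H + T) + fps_const s * (fps_X * H))"
  have R: "(\<lambda>z. 1 / b * ((1 - z) * (b * h z + z * deriv h z) + s * (z * h z))) has_fps_expansion R"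
    unfolding R_def
    by (intro has_fps_expansion_add has_fps_expansion_mult has_fps_expansion_diff
          has_fps_expansion_1 has_fps_expansion_const has_fps_expansion_fps_X hH hT)
  have "f' holomorphic_on - hyp_cut"
    unfolding f'_def using one_minus_powr_holomorphic b hol open_slit
    by (intro holomorphic_on_mult holomorphic_on_add holomorphic_on_divide holomorphic_on_const
          holomorphic_on_ident holomorphic_deriv) auto
  then have F': "f' has_fps_expansion fps_expansion f' 0"
    by (rule has_fps_expansion_fps_expansion[OF open_slit zero_in_slit])
  have "fps_expansion f' 0 = R"
  proof (rule fps_eq_on_slit[OF F' R])
    fix z assume z: "z \<in> - hyp_cut"
    have "(f has_field_derivative deriv f z) (at z)"
      using hol open_slit z by (rule holomorphic_derivI)
    then have "(h has_field_derivative
        - (s * (1 - z) powr s / (1 - z)) * f z + deriv f z * (1 - z) powr s) (at z)"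
      unfolding h_def by (intro DERIV_mult one_minus_powr_deriv z)
    then have dh: "deriv h z = - (s * (1 - z) powr s / (1 - z)) * f z + deriv f z * (1 - z) powr s"
      by (rule DERIV_imp_deriv)
    have nz: "1 - z \<noteq> 0" using slit_neq_1[OF z] by simp
    then have p: "(1 - z) powr (a + (b + 1) - c) = (1 - z) powr s * (1 - z)"
      using powr_add[of "1 - z" s 1] by (simp add: s_def algebra_simps)
    have "(1 - z) * deriv h z = - (s * h z) + (1 - z) * (deriv f z * (1 - z) powr s)"
      unfolding dh h_def using nz by (simp add: field_simps)
    then have "(1 - z) * (b * h z + z * deriv h z) + s * (z * h z)
        = (1 - z) powr s * (1 - z) * (b * f z + z * deriv f z)"
      unfolding h_def by algebra
    moreover have "f z + z * deriv f z / b = (b * f z + z * deriv f z) / b"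
      using b(1) by (simp add: field_simps)
    ultimately show "f' z = 1 / b * ((1 - z) * (b * h z + z * deriv h z) + s * (z * h z))"
      by (simp add: f'_def p)
  qed
  moreover have "R = hyp_fps (c - a) (c - (b + 1)) c"
  proof (rule fps_ext)
    fix m
    show "fps_nth R m = fps_nth (hyp_fps (c - a) (c - (b + 1)) c) m"
    proof (cases m)
      case 0
      then show ?thesis using b by (simp add: R_def T_def H_def hyp_fps_nth)
    next
      case (Suc n)
      define y where "y = fps_nth H n"
      define w where "w = fps_nth H (Suc n)"
      define v where "v = fps_nth (hyp_fps (c - a) (c - (b + 1)) c) (Suc n)"
      have "R = fps_const (1 / b) * (fps_const b * H + T - fps_X * (fps_const b * H + T) + fps_const s * (fps_X * H))"
        unfolding R_def by (simp add: algebra_simps)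
      then have "b * fps_nth R (Suc n) = b * w + of_nat (Suc n) * w - (b * y + of_nat n * y) + s * y"
        using b by (simp add: T_def y_def w_def)
      then have Rn: "b * fps_nth R (Suc n) = (b + of_nat n + 1) * w - (c - a + of_nat n) * y"
        by (simp add: s_def algebra_simps)
      have rec: "w * ((c + of_nat n) * (of_nat n + 1)) = y * ((c - a + of_nat n) * (c - b + of_nat n))"
        using hyp_fps_Suc[OF c, of "c - a" "c - b" n] by (simp add: w_def y_def H_def add.commute)
      have "c - (b + 1) \<noteq> 0 \<Longrightarrow> w = v * (c - b + of_nat n) / (c - (b + 1))"
        using hyp_fps_raise[of "c - (b + 1)" "c - a" c "Suc n"] by (simp add: w_def v_def H_def algebra_simps)
      moreover have "v = 0" if "c - (b + 1) = 0"
        unfolding v_def hyp_fps_nth that by (simp add: pochhammer_0_left)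
      ultimately have wv: "w * (c - b - 1) = v * (c - b + of_nat n)"
        by (cases "c - (b + 1) = 0") (auto simp: field_simps)
      have "(c - b + of_nat n) * (b * fps_nth R (Suc n)) = (c - b + of_nat n) * (b * v)"
        unfolding Rn using rec wv by algebra
      then show ?thesis using b by (simp add: Suc v_def)
    qed
  qed
  ultimately show ?thesis using F' by (simp add: f'_def[abs_def])
qed

text \<open>Started at a continuation of \<open>F(a,1,c)\<close>, the \<open>k\<close>-th iterate continues \<open>F(a,1+k,c)\<close>.\<close>

primrec raise_param :: "(complex \<Rightarrow> complex) \<Rightarrow> nat \<Rightarrow> complex \<Rightarrow> complex" where
  "raise_param f 0 = f"
| "raise_param f (Suc k) = (\<lambda>z. raise_param f k z + z * deriv (raise_param f k) z / of_nat (Suc k))"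

lemma raise_param_holomorphic:
  assumes "f holomorphic_on - hyp_cut"
  shows "raise_param f k holomorphic_on - hyp_cut"
proof (induction k)
  case (Suc k)
  then show ?case
    using open_slit by (auto intro!: holomorphic_intros simp del: of_nat_Suc)
qed (simp add: assms)

lemma raise_param_has_fps_expansion:
  assumes "f has_fps_expansion hyp_fps a 1 c"
  shows "raise_param f k has_fps_expansion hyp_fps a (1 + of_nat k) c"
proof (induction k)
  case (Suc k)
  let ?F = "hyp_fps a (1 + of_nat k) c"
  have "(\<lambda>z. raise_param f k z + 1 / of_nat (Suc k) * (z * deriv (raise_param f k) z)) has_fps_expansion
      ?F + fps_const (1 / of_nat (Suc k)) * Abs_fps (\<lambda>n. of_nat n * fps_nth ?F n)"
    by (intro fps_expansion_intros theta_has_fps_expansion Suc)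
  also have "?F + fps_const (1 / of_nat (Suc k)) * Abs_fps (\<lambda>n. of_nat n * fps_nth ?F n)
      = hyp_fps a (1 + of_nat (Suc k)) c"
  proof (rule fps_ext)
    fix n
    have nz: "(1 + of_nat k :: complex) \<noteq> 0" by (metis of_nat_Suc of_nat_neq_0)
    show "fps_nth (?F + fps_const (1 / of_nat (Suc k)) * Abs_fps (\<lambda>n. of_nat n * fps_nth ?F n)) n
        = fps_nth (hyp_fps a (1 + of_nat (Suc k)) c) n"
      using hyp_fps_raise[OF nz, of a c n] nz by (simp add: field_simps)
  qed
  finally show ?case by simp
qed (simp add: assms)

section \<open>Reduction to \<open>F(a,1,c)\<close> and the polynomial remainder\<close>

definition hyp_poly :: "complex \<Rightarrow> complex \<Rightarrow> nat \<Rightarrow> complex poly" where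
  "hyp_poly a c k = (\<Sum>n\<le>k. monom (fps_nth (hyp_fps (1 - a) (- of_nat k) (2 - c)) n) n)"

lemma coeff_hyp_poly: "coeff (hyp_poly a c k) n = fps_nth (hyp_fps (1 - a) (- of_nat k) (2 - c)) n"
proof -
  have "fps_nth (hyp_fps (1 - a) (- of_nat k) (2 - c)) n = 0" if "n > k"
    using that by (intro hyp_fps_eventually_0[of _ k]) auto
  then show ?thesis by (auto simp: hyp_poly_def coeff_sum)
qed

lemma degree_hyp_poly: "degree (hyp_poly a c k) \<le> k"
  by (rule degree_le) (auto simp: coeff_hyp_poly intro!: hyp_fps_eventually_0[of _ k])

lemma hyp2F1_eq_hyp_poly: "hyp2F1 (1 - a) (- of_nat k) (2 - c) x = poly (hyp_poly a c k) x"
proof -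
  let ?F = "hyp_fps (1 - a) (- of_nat k) (2 - c)"
  have *: "fps_nth ?F n * x ^ n = 0" if "n \<notin> {..k}" for n
    using that hyp_fps_eventually_0[of "1 - a" k "- of_nat k" n] by auto
  then have "summable (\<lambda>n. fps_nth ?F n * x ^ n)"
    by (intro summable_finite[of "{..k}"]) auto
  moreover have "eval_fps ?F x = (\<Sum>n\<le>k. fps_nth ?F n * x ^ n)"
    unfolding eval_fps_def using * by (intro suminf_finite) auto
  ultimately show ?thesis
    by (simp add: hyp2F1_def hyp_poly_def poly_sum poly_monom)
qed

text \<open>Multiplied by \<open>(2-c,k)\<close>, this is the recurrence for the coefficient of \<open>F(a,1,c)\<close> when
  \<open>F(a,1+k,c)\<close> is reduced to \<open>F(a,1,c)\<close> by the differential equation; it is the reason why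
  \<open>F(1-a,-k,2-c)\<close> appears there.\<close>

lemma hyp_poly_Suc:
  assumes c: "c \<notin> \<int>"
  shows "smult (of_nat k + 2 - c) (hyp_poly a c (Suc k))
    = [:0, 1, -1:] * pderiv (hyp_poly a c k) + [:of_nat k + 2 - c, a - 1:] * hyp_poly a c k"
proof (rule poly_eqI)
  fix m
  have c2: "2 - c \<notin> \<int>"
  proof
    assume "2 - c \<in> \<int>"
    then have "2 - (2 - c) \<in> \<int>" by (intro Ints_diff) auto
    with c show False by simp
  qed
  let ?p = "coeff (hyp_poly a c k)" and ?q = "coeff (hyp_poly a c (Suc k))"
  show "coeff (smult (of_nat k + 2 - c) (hyp_poly a c (Suc k))) m
    = coeff ([:0, 1, -1:] * pderiv (hyp_poly a c k) + [:of_nat k + 2 - c, a - 1:] * hyp_poly a c k) m"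
  proof (cases m)
    case 0
    then show ?thesis by (simp add: coeff_hyp_poly hyp_fps_nth)
  next
    case (Suc n)
    have "coeff (pCons 0 (pderiv (hyp_poly a c k))) n = of_nat n * ?p n"
      and "coeff (pCons 0 (- pderiv (hyp_poly a c k))) n = - (of_nat n * ?p n)"
      by (cases n; auto simp: coeff_pderiv)+
    then have rhs: "coeff ([:0, 1, -1:] * pderiv (hyp_poly a c k) + [:of_nat k + 2 - c, a - 1:] * hyp_poly a c k) m
        = (of_nat k + 2 - c + of_nat n + 1) * ?p (Suc n) - (of_nat n + 1 - a) * ?p n"
      using Suc by (simp add: coeff_pderiv algebra_simps)
    have nz: "- of_nat (Suc k) \<noteq> (0 :: complex)" by (simp del: of_nat_Suc)
    have "?p n = ?q n * (- of_nat (Suc k) + of_nat n) / - of_nat (Suc k)"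
      using hyp_fps_raise[OF nz, of "1 - a" "2 - c" n] by (simp add: coeff_hyp_poly)
    then have pq: "?p n * (of_nat k + 1) = ?q n * (of_nat k + 1 - of_nat n)"
      using nz by (simp add: field_simps)
    have p: "?p (Suc n) * ((2 - c + of_nat n) * (of_nat n + 1))
        = ?p n * ((1 - a + of_nat n) * (- of_nat k + of_nat n))"
      using hyp_fps_Suc[OF c2, of "1 - a" "- of_nat k" n] by (simp add: coeff_hyp_poly add.commute)
    have q: "?q (Suc n) * ((2 - c + of_nat n) * (of_nat n + 1))
        = ?q n * ((1 - a + of_nat n) * (- (of_nat k + 1) + of_nat n))"
      using hyp_fps_Suc[OF c2, of "1 - a" "- of_nat (Suc k)" n] by (simp add: coeff_hyp_poly add.commute)
    \<comment> \<open>all three coefficients are expressed by \<open>?q n\<close> after clearing the common denominator\<close>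
    have "((2 - c + of_nat n) * (of_nat n + 1)) * ((of_nat k + 2 - c) * ?q (Suc n))
        = ((2 - c + of_nat n) * (of_nat n + 1)) *
          ((of_nat k + 2 - c + of_nat n + 1) * ?p (Suc n) - (of_nat n + 1 - a) * ?p n)"
      using pq p q by algebra
    moreover have "(2 - c + of_nat n) * (of_nat n + 1) \<noteq> 0"
      using nonint_add_nat(1)[OF c2] of_nat_neq_0[of n] by (metis add.commute mult_eq_0_iff of_nat_Suc)
    ultimately have "(of_nat k + 2 - c) * ?q (Suc n)
        = (of_nat k + 2 - c + of_nat n + 1) * ?p (Suc n) - (of_nat n + 1 - a) * ?p n"
      by (metis mult_left_cancel)
    then show ?thesis using rhs Suc by simp
  qed
qed

text \<open>The inhomogeneous part of the same reduction: \<open>- rem_poly a c l / (1 - c)\<close> is the polynomial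
  \<open>q\<^sub>0\<close>.\<close>

primrec rem_poly :: "complex \<Rightarrow> complex \<Rightarrow> nat \<Rightarrow> complex poly" where
  "rem_poly a c 0 = 0"
| "rem_poly a c (Suc k) = [:0, 1, -1:] * pderiv (rem_poly a c k) + [:of_nat (Suc k), -1:] * rem_poly a c k
     + smult ((c - 1) * pochhammer (2 - c) k) (hyp_poly a c k)"

text \<open>Each step of the recursion raises the degree by at most 1, and the summand \<^const>\<open>hyp_poly\<close>
  has degree at most \<open>k\<close>.  The vanishing of coefficients covers the zero polynomial at \<open>k = 0\<close>, which
  a bound by the truncated \<open>k - 1\<close> would not.\<close>

lemma coeff_rem_poly: "k \<le> n \<Longrightarrow> coeff (rem_poly a c k) n = 0"
proof (induction k arbitrary: n)
  case (Suc k)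
  then obtain m where n: "n = Suc m" "k \<le> m" by (cases n) auto
  have "coeff (pCons 0 (- pderiv (rem_poly a c k))) m = - (of_nat m * coeff (rem_poly a c k) m)"
    by (cases m) (auto simp: coeff_pderiv)
  moreover have "coeff (hyp_poly a c k) n = 0"
    using n degree_hyp_poly[of a c k] by (intro coeff_eq_0) auto
  ultimately show ?case
    using Suc.IH[of m] Suc.IH[of n] n by (simp add: coeff_pderiv del: of_nat_Suc)
qed simp

lemma degree_rem_poly: "degree (rem_poly a c k) \<le> k - 1"
  by (rule degree_le) (auto intro: coeff_rem_poly)

text \<open>With \<open>G = k! (1 - z)\<^sup>k f\<^sub>k\<close>, one more raising step gives
  \<open>(1 - z) z G' + (k + 1 - z) G\<close>.  Applied to \<open>Q P f + B\<close>, the differential equation replaces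
  \<open>z (1 - z) f'\<close> by a linear expression in \<open>f\<close>, and the recurrences of \<^const>\<open>hyp_poly\<close> and
  \<^const>\<open>rem_poly\<close> collect the two parts.\<close>

lemma raise_param_closed_form:
  assumes c: "c \<notin> \<int>" and hol: "f holomorphic_on - hyp_cut"
    and ode: "\<And>z. z \<in> - hyp_cut \<Longrightarrow> (1 - z) * (z * deriv f z) + (c - 1 - a * z) * f z = c - 1"
    and z: "z \<in> - hyp_cut"
  shows "fact k * (1 - z) ^ k * raise_param f k z
    = pochhammer (2 - c) k * poly (hyp_poly a c k) z * f z + poly (rem_poly a c k) z"
  using z
proof (induction k arbitrary: z)
  case 0
  then show ?case by (simp add: hyp_poly_def hyp_fps_nth)
next
  case (Suc k)
  define r where "r = raise_param f k z"
  define r' where "r' = deriv (raise_param f k) z"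
  define P where "P = hyp_poly a c k"
  define B where "B = rem_poly a c k"
  define Q where "Q = pochhammer (2 - c) k"
  define d where "d = Q * (poly (pderiv P) z * f z + poly P z * deriv f z) + poly (pderiv B) z"
  define E where "E = (1 - z) ^ k"
  define D where "D = (1 - z) ^ (k - 1)"
  have df: "(f has_field_derivative deriv f z) (at z)"
    using hol open_slit Suc.prems by (rule holomorphic_derivI)
  have dr: "(raise_param f k has_field_derivative r') (at z)"
    unfolding r'_def using raise_param_holomorphic[OF hol] open_slit Suc.prems by (rule holomorphic_derivI)
  \<comment> \<open>both sides of the induction hypothesis are differentiated\<close>
  have "((\<lambda>z. Q * poly P z * f z + poly B z) has_field_derivative d) (at z)"
    unfolding d_def by (auto intro!: derivative_eq_intros df simp: algebra_simps)
  then have "((\<lambda>z. fact k * (1 - z) ^ k * raise_param f k z) has_field_derivative d) (at z)"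
    by (rule has_field_derivative_transform_within_open[OF _ open_slit Suc.prems])
       (simp add: Suc.IH Q_def P_def B_def)
  moreover have "((\<lambda>z. (1 - z) ^ k) has_field_derivative - (of_nat k * (1 - z) ^ (k - 1))) (at z)"
    by (auto intro!: derivative_eq_intros)
  then have "((\<lambda>z. fact k * (1 - z) ^ k * raise_param f k z) has_field_derivative
      fact k * - (of_nat k * (1 - z) ^ (k - 1)) * r + r' * (fact k * E)) (at z)"
    unfolding r_def E_def by (intro DERIV_mult DERIV_cmult dr)
  ultimately have "d = fact k * - (of_nat k * D) * r + r' * (fact k * E)"
    unfolding D_def by (rule DERIV_unique)
  moreover have "of_nat k * D * (1 - z) = of_nat k * E"
    by (cases k) (auto simp: E_def D_def)
  ultimately have d: "(1 - z) * d = fact k * (E * (1 - z) * r' - of_nat k * E * r)"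
    by algebra
  have eq: "fact k * E * r = Q * poly P z * f z + poly B z"
    using Suc.IH[OF Suc.prems] by (simp add: r_def E_def Q_def P_def B_def)
  have "poly (smult (of_nat k + 2 - c) (hyp_poly a c (Suc k))) z
      = poly ([:0, 1, -1:] * pderiv P + [:of_nat k + 2 - c, a - 1:] * P) z"
    unfolding P_def hyp_poly_Suc[OF c] ..
  then have P': "(of_nat k + 2 - c) * poly (hyp_poly a c (Suc k)) z
      = (1 - z) * z * poly (pderiv P) z + (of_nat k + 2 - c + (a - 1) * z) * poly P z"
    by (simp add: algebra_simps)
  have B': "poly (rem_poly a c (Suc k)) z
      = (1 - z) * z * poly (pderiv B) z + (of_nat k + 1 - z) * poly B z + (c - 1) * Q * poly P z"
    by (simp add: B_def P_def Q_def algebra_simps)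
  have Q': "pochhammer (2 - c) (Suc k) = Q * (of_nat k + 2 - c)"
    by (simp add: Q_def pochhammer_rec' algebra_simps)
  have nz: "(of_nat k + 1 :: complex) \<noteq> 0" by (metis of_nat_Suc of_nat_neq_0 add.commute)
  have "fact (Suc k) * (1 - z) ^ Suc k * raise_param f (Suc k) z
      = (of_nat k + 1) * fact k * ((1 - z) * E) * (r + z * r' / (of_nat k + 1))"
    by (simp add: r_def r'_def E_def add.commute)
  also have "\<dots> = fact k * ((1 - z) * E) * ((of_nat k + 1) * r + z * r')"
    using nz by (simp add: field_simps)
  also have "\<dots> = z * ((1 - z) * d) + (of_nat k + 1 - z) * (fact k * E * r)"
    unfolding d by algebra
  also have "\<dots> = Q * ((of_nat k + 2 - c) * poly (hyp_poly a c (Suc k)) z) * f z + poly (rem_poly a c (Suc k)) z"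
    unfolding eq P' B' d_def using ode[OF Suc.prems] by algebra
  finally show ?case unfolding Q' by (simp only: mult.assoc)
qed

text \<open>All functions involved are built from one solution \<open>g\<close> of the equation \<open>x g' + s g = h\<close>, so one
  limit of \<open>g\<close> gives their values at \<open>x\<close>, and the identities on the slit plane become identities
  between values of \<^const>\<open>hyp2F1\<close>, on the cut as well.\<close>

lemma hyp2F1_closed_forms:
  assumes c: "c \<notin> \<int>" and x: "x \<noteq> 1"
  shows "fact l * (1 - x) ^ l * hyp2F1 a (1 + of_nat l) c x
      = pochhammer (2 - c) l * poly (hyp_poly a c l) x * hyp2F1 a 1 c x + poly (rem_poly a c l) x"
    and "hyp2F1 (c - a) (c - 1 - of_nat l) c x
      = (1 - x) powr (a + 1 + of_nat l - c) * hyp2F1 a (1 + of_nat l) c x"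
proof -
  obtain g where g: "g holomorphic_on - hyp_cut"
    and g_ode: "\<And>z. z \<in> - hyp_cut \<Longrightarrow> z * deriv g z + (c - 1) * g z = (c - 1) * (1 - z) powr (a - c)"
    and g_exp: "g has_fps_expansion hyp_fps (c - a) (c - 1) c"
    using continuation_base[OF c, of a] by blast
  define f where "f z = (1 - z) powr (c - a - 1) * g z" for z
  have f: "f holomorphic_on - hyp_cut"
    unfolding f_def by (intro holomorphic_on_mult one_minus_powr_holomorphic g)
  have ode: "(1 - z) * (z * deriv f z) + (c - 1 - a * z) * f z = c - 1" if z: "z \<in> - hyp_cut" for z
  proof -
    have nz: "1 - z \<noteq> 0" using slit_neq_1[OF z] by simp
    define e where "e = (1 - z) powr (c - a - 1)"
    have "(g has_field_derivative deriv g z) (at z)"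
      using g open_slit z by (rule holomorphic_derivI)
    then have "(f has_field_derivative - ((c - a - 1) * e / (1 - z)) * g z + deriv g z * e) (at z)"
      unfolding f_def e_def by (intro DERIV_mult one_minus_powr_deriv z)
    then have "deriv f z = - ((c - a - 1) * e / (1 - z)) * g z + deriv g z * e"
      by (rule DERIV_imp_deriv)
    then have df: "(1 - z) * deriv f z = - ((c - a - 1) * e * g z) + (1 - z) * (deriv g z * e)"
      using nz by (simp add: field_simps)
    have "(1 - z) powr (a - c) * e * (1 - z) powr 1 = (1 - z) powr (a - c + (c - a - 1) + 1)"
      unfolding e_def powr_add ..
    then have e: "(1 - z) powr (a - c) * e * (1 - z) = 1" using nz by simp
    show ?thesis
      using df e g_ode[OF z] unfolding f_def e_def[symmetric] by algebra
  qed
  have f_exp: "f has_fps_expansion hyp_fps a 1 c"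
    using has_fps_expansion_fps_expansion[OF open_slit zero_in_slit f]
      first_order_ode_expansion[OF c _ ode] by metis
  obtain L where L: "(f \<longlongrightarrow> L) (at x within approach x)"
  proof (cases "x \<in> hyp_cut")
    case True
    obtain M where "(g \<longlongrightarrow> M) (at x within approach x)"
      using euler_ode_limit_below_cut[OF g g_ode True x] by blast
    then have "(f \<longlongrightarrow> (1 - x) powr (c - a - 1) * M) (at x within approach x)"
      unfolding f_def by (intro tendsto_mult one_minus_powr_tendsto x)
    then show ?thesis by (rule that)
  next
    case False
    then show ?thesis using holomorphic_tendsto_approach[OF f] that by blast
  qed
  then have val_f: "hyp2F1 a 1 c x = L"
    using hyp2F1_eqI[OF c f f_exp x] by blast
  define q where "q z w = (pochhammer (2 - c) l * poly (hyp_poly a c l) z * w + poly (rem_poly a c l) z) / (fact l * (1 - z) ^ l)" for z w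
  define r where "r = raise_param f l"
  have "((\<lambda>z. q z (f z)) \<longlongrightarrow> q x L) (at x within approach x)"
    unfolding q_def using x by (intro tendsto_intros L) auto
  moreover have "eventually (\<lambda>z. q z (f z) = r z) (at x within approach x)"
    using eventually_approach_slit
  proof eventually_elim
    case (elim z)
    then have "fact l * (1 - z) ^ l \<noteq> 0" using slit_neq_1[OF elim] by simp
    moreover have "q z (f z) = fact l * (1 - z) ^ l * r z / (fact l * (1 - z) ^ l)"
      by (simp only: q_def r_def raise_param_closed_form[OF c f ode elim])
    ultimately show ?case by (simp only: nonzero_mult_div_cancel_left not_False_eq_True)
  qed
  ultimately have r_lim: "(r \<longlongrightarrow> q x L) (at x within approach x)"
    by (rule Lim_transform_eventually)
  have r_hol: "r holomorphic_on - hyp_cut"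
    unfolding r_def by (rule raise_param_holomorphic[OF f])
  have val_r: "hyp2F1 a (1 + of_nat l) c x = q x L"
    using hyp2F1_eqI[OF c r_hol _ x r_lim] raise_param_has_fps_expansion[OF f_exp] by (simp add: r_def)
  then show "fact l * (1 - x) ^ l * hyp2F1 a (1 + of_nat l) c x
      = pochhammer (2 - c) l * poly (hyp_poly a c l) x * hyp2F1 a 1 c x + poly (rem_poly a c l) x"
    using x by (simp add: q_def val_f)
  have "(\<lambda>z. (1 - z) powr (a + (1 + of_nat k) - c) * raise_param f k z)
      has_fps_expansion hyp_fps (c - a) (c - (1 + of_nat k)) c" for k
  proof (induction k)
    case 0
    have "(\<lambda>z. (1 - z) powr (a + 1 - c) * f z) has_fps_expansion hyp_fps (c - a) (c - 1) c
        \<longleftrightarrow> g has_fps_expansion hyp_fps (c - a) (c - 1) c"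
    proof (rule has_fps_expansion_cong)
      show "eventually (\<lambda>z. (1 - z) powr (a + 1 - c) * f z = g z) (nhds 0)"
        using eventually_nhds_in_open[OF open_slit zero_in_slit]
      proof eventually_elim
        case (elim z)
        have "(1 - z) powr (a + 1 - c) * (1 - z) powr (c - a - 1) = (1 - z) powr (a + 1 - c + (c - a - 1))"
          by (rule powr_add[symmetric])
        also have "\<dots> = 1" using slit_neq_1[OF elim] by simp
        finally show ?case by (simp add: f_def flip: mult.assoc)
      qed
    qed simp
    then show ?case using g_exp by simp
  next
    case (Suc k)
    have "c - (1 + of_nat k) + of_nat n \<noteq> 0" for n
    proof
      assume "c - (1 + of_nat k) + of_nat n = 0"
      then have "c = of_int (1 + int k - int n)" by (simp add: algebra_simps)
      with c show False by (metis Ints_of_int)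
    qed
    moreover have "(1 + of_nat k :: complex) \<noteq> 0" by (metis of_nat_Suc of_nat_neq_0)
    ultimately show ?case
      using euler_step_expansion[OF c _ _ raise_param_holomorphic[OF f] Suc] by (simp add: add_ac)
  qed
  then have "(\<lambda>z. (1 - z) powr (a + 1 + of_nat l - c) * r z) has_fps_expansion
      hyp_fps (c - a) (c - 1 - of_nat l) c"
    by (simp add: r_def diff_diff_eq add.assoc)
  moreover have "(\<lambda>z. (1 - z) powr (a + 1 + of_nat l - c) * r z) holomorphic_on - hyp_cut"
    by (intro holomorphic_on_mult one_minus_powr_holomorphic r_hol)
  moreover have "((\<lambda>z. (1 - z) powr (a + 1 + of_nat l - c) * r z)
      \<longlongrightarrow> (1 - x) powr (a + 1 + of_nat l - c) * q x L) (at x within approach x)"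
    by (intro tendsto_mult one_minus_powr_tendsto x r_lim)
  ultimately show "hyp2F1 (c - a) (c - 1 - of_nat l) c x
      = (1 - x) powr (a + 1 + of_nat l - c) * hyp2F1 a (1 + of_nat l) c x"
    unfolding val_r by (intro hyp2F1_eqI[OF c _ _ x])
qed

section \<open>Values at the roots\<close>

lemma hyp2F1_at_root:
  assumes c: "c \<notin> \<int>" and x: "x \<noteq> 1" and root: "poly (hyp_poly a c l) x = 0"
  shows "hyp2F1 a (1 + of_nat l) c x = poly (rem_poly a c l) x / (fact l * (1 - x) ^ l)"
    and "hyp2F1 (c - a) (c - 1 - of_nat l) c x
      = (1 - x) powr (a + 1 - c) * poly (rem_poly a c l) x / fact l"
proof -
  show val: "hyp2F1 a (1 + of_nat l) c x = poly (rem_poly a c l) x / (fact l * (1 - x) ^ l)"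
    using hyp2F1_closed_forms(1)[OF c x, of l a] x root by (simp add: field_simps)
  have "(1 - x) powr (a + 1 - c + of_nat l) = (1 - x) powr (a + 1 - c) * (1 - x) ^ l"
    using x by (simp add: powr_add powr_nat')
  then have p: "(1 - x) powr (a + 1 + of_nat l - c) = (1 - x) powr (a + 1 - c) * (1 - x) ^ l"
    by (simp add: algebra_simps)
  show "hyp2F1 (c - a) (c - 1 - of_nat l) c x
      = (1 - x) powr (a + 1 - c) * poly (rem_poly a c l) x / fact l"
    using x unfolding hyp2F1_closed_forms(2)[OF c x] val p by simp
qed

theorem theorem1p1:
  fixes l :: nat and a c :: complex
  assumes "l > 0" and "c \<notin> \<int>"
  shows
    "(\<exists>p :: complex poly. degree p \<le> l \<and>
        (\<forall>x. poly p x = hyp2F1 (1 - a) (- of_nat l) (2 - c) x)) \<and>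
     (\<exists>q0 :: complex poly. degree q0 \<le> l - 1 \<and>
        (\<forall>x. x \<noteq> 1 \<longrightarrow>
           poly q0 x =
             - (pochhammer 1 l / (1 - c)) * (1 - x) powr (c - a - 1)
                 * hyp2F1 (c - a) (c - 1 - of_nat l) c x
             + pochhammer (2 - c) l / (1 - c) * hyp2F1 a 1 c x
                 * hyp2F1 (1 - a) (- of_nat l) (2 - c) x) \<and>
        (\<forall>r. hyp2F1 (1 - a) (- of_nat l) (2 - c) r = 0 \<and> r \<noteq> 1 \<longrightarrow>
           hyp2F1 a (1 + of_nat l) c r
             = - ((1 - c) * poly q0 r / (pochhammer 1 l * (1 - r) ^ l)) \<and>
           hyp2F1 (c - a) (c - 1 - of_nat l) c r
             = - ((1 - c) / pochhammer 1 l) * (1 - r) powr (a + 1 - c) * poly q0 r)) \<and>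
     (a \<noteq> 1 \<and> a + 1 - c \<noteq> 0 \<longrightarrow>
        hyp2F1 a 2 c ((c - 2) / (a - 1)) = (a - 1) * (c - 1) / (a + 1 - c) \<and>
        hyp2F1 (c - a) (c - 2) c ((c - 2) / (a - 1))
          = (c - 1) * ((a + 1 - c) / (a - 1)) powr (a + 1 - c))"
proof (intro conjI)
  note c = \<open>c \<notin> \<int>\<close>
  have c1: "1 - c \<noteq> 0" using nonint_add_nat(2)[OF c, of 1] by simp
  show "\<exists>p :: complex poly. degree p \<le> l \<and>
        (\<forall>x. poly p x = hyp2F1 (1 - a) (- of_nat l) (2 - c) x)"
    using degree_hyp_poly hyp2F1_eq_hyp_poly by metis
  show "\<exists>q0 :: complex poly. degree q0 \<le> l - 1 \<and>
        (\<forall>x. x \<noteq> 1 \<longrightarrow>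
           poly q0 x =
             - (pochhammer 1 l / (1 - c)) * (1 - x) powr (c - a - 1)
                 * hyp2F1 (c - a) (c - 1 - of_nat l) c x
             + pochhammer (2 - c) l / (1 - c) * hyp2F1 a 1 c x
                 * hyp2F1 (1 - a) (- of_nat l) (2 - c) x) \<and>
        (\<forall>r. hyp2F1 (1 - a) (- of_nat l) (2 - c) r = 0 \<and> r \<noteq> 1 \<longrightarrow>
           hyp2F1 a (1 + of_nat l) c r
             = - ((1 - c) * poly q0 r / (pochhammer 1 l * (1 - r) ^ l)) \<and>
           hyp2F1 (c - a) (c - 1 - of_nat l) c r
             = - ((1 - c) / pochhammer 1 l) * (1 - r) powr (a + 1 - c) * poly q0 r)"
  proof (intro exI[of _ "smult (- (1 / (1 - c))) (rem_poly a c l)"] conjI allI impI)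
    show "degree (smult (- (1 / (1 - c))) (rem_poly a c l)) \<le> l - 1"
      using degree_rem_poly by simp
  next
    fix x :: complex
    assume x: "x \<noteq> 1"
    have "(1 - x) powr (c - a - 1) * (1 - x) powr (a + 1 + of_nat l - c)
        = (1 - x) powr (c - a - 1 + (a + 1 + of_nat l - c))"
      by (rule powr_add[symmetric])
    also have "\<dots> = (1 - x) ^ l" using x by (simp add: powr_nat')
    finally have p: "(1 - x) powr (c - a - 1) * (1 - x) powr (a + 1 + of_nat l - c) = (1 - x) ^ l" .
    have "(1 - x) powr (c - a - 1) * hyp2F1 (c - a) (c - 1 - of_nat l) c x
        = (1 - x) ^ l * hyp2F1 a (1 + of_nat l) c x"
      unfolding hyp2F1_closed_forms(2)[OF c x] p[symmetric] by (rule mult.assoc[symmetric])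
    then have rem: "poly (rem_poly a c l) x = fact l * ((1 - x) powr (c - a - 1) * hyp2F1 (c - a) (c - 1 - of_nat l) c x)
        - pochhammer (2 - c) l * poly (hyp_poly a c l) x * hyp2F1 a 1 c x"
      using hyp2F1_closed_forms(1)[OF c x, of l a] by (simp add: mult.assoc)
    show "poly (smult (- (1 / (1 - c))) (rem_poly a c l)) x =
             - (pochhammer 1 l / (1 - c)) * (1 - x) powr (c - a - 1)
                 * hyp2F1 (c - a) (c - 1 - of_nat l) c x
             + pochhammer (2 - c) l / (1 - c) * hyp2F1 a 1 c x
                 * hyp2F1 (1 - a) (- of_nat l) (2 - c) x"
      unfolding hyp2F1_eq_hyp_poly poly_smult pochhammer_fact[symmetric] rem
      by (simp add: divide_inverse algebra_simps)
  next
    fix r :: complex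
    assume r: "hyp2F1 (1 - a) (- of_nat l) (2 - c) r = 0 \<and> r \<noteq> 1"
    then have "poly (hyp_poly a c l) r = 0" by (simp add: hyp2F1_eq_hyp_poly)
    note root = hyp2F1_at_root[OF c conjunct2[OF r] this]
    show "hyp2F1 a (1 + of_nat l) c r
        = - ((1 - c) * poly (smult (- (1 / (1 - c))) (rem_poly a c l)) r / (pochhammer 1 l * (1 - r) ^ l))"
      using c1 root(1) by (simp add: pochhammer_fact[symmetric])
    show "hyp2F1 (c - a) (c - 1 - of_nat l) c r
        = - ((1 - c) / pochhammer 1 l) * (1 - r) powr (a + 1 - c)
            * poly (smult (- (1 / (1 - c))) (rem_poly a c l)) r"
      using c1 root(2) by (simp add: pochhammer_fact[symmetric])
  qed
  show "a \<noteq> 1 \<and> a + 1 - c \<noteq> 0 \<longrightarrow>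
        hyp2F1 a 2 c ((c - 2) / (a - 1)) = (a - 1) * (c - 1) / (a + 1 - c) \<and>
        hyp2F1 (c - a) (c - 2) c ((c - 2) / (a - 1))
          = (c - 1) * ((a + 1 - c) / (a - 1)) powr (a + 1 - c)"
  proof
    assume ac: "a \<noteq> 1 \<and> a + 1 - c \<noteq> 0"
    define r where "r = (c - 2) / (a - 1)"
    have r1: "1 - r = (a + 1 - c) / (a - 1)" using ac by (simp add: r_def field_simps)
    then have "r \<noteq> 1" using ac by auto
    have c2: "2 - c \<noteq> 0" using nonint_add_nat(2)[OF c, of 2] by simp
    have "poly (hyp_poly a c 1) r = 1 + (a - 1) * r / (2 - c)"
      by (simp add: hyp_poly_def hyp_fps_nth poly_monom)
    also have "(a - 1) * r = - (2 - c)" using ac by (simp add: r_def)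
    also have "1 + - (2 - c) / (2 - c) = 0" using c2 by (simp add: field_simps)
    finally have "poly (hyp_poly a c 1) r = 0" .
    note root = hyp2F1_at_root[OF c \<open>r \<noteq> 1\<close> this]
    have B: "poly (rem_poly a c 1) r = c - 1"
      by (simp add: hyp_poly_def hyp_fps_nth)
    have "hyp2F1 a 2 c r = (c - 1) / (1 - r)"
      using root(1) B by simp
    moreover have "hyp2F1 (c - a) (c - 2) c r = (1 - r) powr (a + 1 - c) * (c - 1)"
      using root(2) B by (simp add: diff_diff_eq)
    ultimately show "hyp2F1 a 2 c ((c - 2) / (a - 1)) = (a - 1) * (c - 1) / (a + 1 - c) \<and>
        hyp2F1 (c - a) (c - 2) c ((c - 2) / (a - 1))
          = (c - 1) * ((a + 1 - c) / (a - 1)) powr (a + 1 - c)"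
      unfolding r_def[symmetric] r1 using ac by (simp add: mult.commute)
  qed
qed

end
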